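(* Let $N\ge 1$ and $n\ge 0$ be integers and let $\{\mathbf{a}_0,\ldots,\mathbf{a}_n\}\subset\mathbb{R}^N$ be geometrically independent. Then the $n$-simplex $\sigma_n$ spanned by $\mathbf{a}_0,\ldots,\mathbf{a}_n$ is a compact subset of $\mathbb{R}^N$.
   Context: Points $\mathbf{a}_0,\ldots,\mathbf{a}_n$ of $\mathbb{R}^N$ are geometrically independent if for all real scalars $t_i$, the equations $\sum_{i=0}^n t_i=0$ and $\sum_{i=0}^n t_i\mathbf{a}_i=\mathbf{0}$ imply $t_i=0$ for all $i$. The $n$-simplex spanned by such points is $\sigma_n=\{\sum_{i=0}^n t_i\mathbf{a}_i : t_i\ge 0,\ \sum_{i=0}^n t_i=1\}$. *)

theory Defs
  imports "HOL-Analysis.Analysis"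
begin

(* The points a_0, ..., a_n are the values of a :: nat => real^'N at the indices i <= n;
   the values at larger indices play no role. Independence is a property of the indexed
   family, so it also forces the points to be distinct. *)

definition geometrically_independent :: "nat \<Rightarrow> (nat \<Rightarrow> real ^ 'N) \<Rightarrow> bool" where
  "geometrically_independent n a \<longleftrightarrow>
    (\<forall>t :: nat \<Rightarrow> real. (\<Sum>i\<le>n. t i) = 0 \<and> (\<Sum>i\<le>n. t i *\<^sub>R a i) = 0 \<longrightarrow> (\<forall>i\<le>n. t i = 0))"

definition spanned_simplex :: "nat \<Rightarrow> (nat \<Rightarrow> real ^ 'N) \<Rightarrow> (real ^ 'N) set" where
  "spanned_simplex n a =
    {(\<Sum>i\<le>n. t i *\<^sub>R a i) | t :: nat \<Rightarrow> real. (\<forall>i\<le>n. t i \<ge> 0) \<and> (\<Sum>i\<le>n. t i) = 1}"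

end

theory Submission
  imports Defs
begin

text \<open>The simplex is the convex hull of its finitely many vertices, and the convex hull of a
  finite set is compact (\<open>finite_imp_compact_convex_hull\<close>). The work therefore lies in
  \<open>spanned_simplex_eq_convex_hull\<close>, which passes from explicit barycentric coordinates
  to the abstract hull.\<close>

lemma spanned_simplexI:
  assumes "x = (\<Sum>i\<le>n. t i *\<^sub>R a i)" "\<And>i. i \<le> n \<Longrightarrow> t i \<ge> 0" "(\<Sum>i\<le>n. t i) = 1"
  shows "x \<in> spanned_simplex n a"
  using assms unfolding spanned_simplex_def by blast

text \<open>A convex set is closed under finite convex combinations, so the hull absorbs every point
  of the simplex. Conversely, the hull is the least convex set containing the vertices, so it is
  enough that the simplex is convex and contains them.\<close>

lemma spanned_simplex_eq_convex_hull:
  "spanned_simplex n a = convex hull (a ` {..n})"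
proof
  show "spanned_simplex n a \<subseteq> convex hull (a ` {..n})"
    unfolding spanned_simplex_def
    by (auto intro!: convex_sum simp: hull_inc)
next
  show "convex hull (a ` {..n}) \<subseteq> spanned_simplex n a"
  proof (rule hull_minimal)
    show "a ` {..n} \<subseteq> spanned_simplex n a"
    proof
      fix x assume "x \<in> a ` {..n}"
      then obtain j where j: "j \<le> n" "x = a j" by auto
      \<comment> \<open>Barycentric coordinates of the vertex \<open>a j\<close>: the Kronecker
        delta at \<open>j\<close>.\<close>
      let ?t = "\<lambda>i. if i = j then 1 else 0 :: real"
      have "(\<Sum>i\<le>n. ?t i *\<^sub>R a i) = (\<Sum>i\<le>n. if i = j then a i else 0)"
        by (intro sum.cong) auto
      with j have "x = (\<Sum>i\<le>n. ?t i *\<^sub>R a i)" "(\<Sum>i\<le>n. ?t i) = 1"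
        by auto
      then show "x \<in> spanned_simplex n a"
        by (intro spanned_simplexI[where t = ?t]) auto
    qed
    show "convex (spanned_simplex n a)"
    proof (rule convexI)
      fix x y and u v :: real
      assume "x \<in> spanned_simplex n a" "y \<in> spanned_simplex n a"
        and uv: "0 \<le> u" "0 \<le> v" "u + v = 1"
      then obtain s t where
        s: "x = (\<Sum>i\<le>n. s i *\<^sub>R a i)" "\<forall>i\<le>n. s i \<ge> 0" "(\<Sum>i\<le>n. s i) = 1" and
        t: "y = (\<Sum>i\<le>n. t i *\<^sub>R a i)" "\<forall>i\<le>n. t i \<ge> 0" "(\<Sum>i\<le>n. t i) = 1"
        unfolding spanned_simplex_def by blast
      \<comment> \<open>Coordinates combine just as the points do; the total weight is
        \<open>u * 1 + v * 1 = 1\<close>.\<close>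
      let ?w = "\<lambda>i. u * s i + v * t i"
      have "u *\<^sub>R x + v *\<^sub>R y = (\<Sum>i\<le>n. ?w i *\<^sub>R a i)"
        by (simp add: s t scaleR_sum_right scaleR_add_left sum.distrib)
      moreover have "?w i \<ge> 0" if "i \<le> n" for i
        using s t uv that by simp
      moreover have "(\<Sum>i\<le>n. ?w i) = 1"
        using s t uv by (simp add: sum.distrib flip: sum_distrib_left)
      ultimately show "u *\<^sub>R x + v *\<^sub>R y \<in> spanned_simplex n a"
        by (rule spanned_simplexI)
    qed
  qed
qed

theorem theorem3p15:
  fixes n :: nat and a :: "nat \<Rightarrow> real ^ 'N"
  assumes "geometrically_independent n a"
  shows "compact (spanned_simplex n a)"
  by (simp add: spanned_simplex_eq_convex_hull finite_imp_compact_convex_hull)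

end
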